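(* Let $d\ge 1$ and let $a:\mathbb R^d\to[0,\infty)$ be a bounded, continuous, even, integrable function with $\int_{\mathbb R^d}a(x)\,dx=1$. Suppose that there are constants $\alpha>0$ and $0<c_-\le c_+$ such that $$c_-(1+|x|)^{-(d+\alpha)}\le a(x)\le c_+(1+|x|)^{-(d+\alpha)}\quad\text{for all }x\in\mathbb R^d .$$ For $\lambda>0$ let $G_\lambda(x)=\sum_{k=1}^\infty (1+\lambda)^{-k}a_k(x)$, where $a_k=a^{*k}$ is the $k$-fold convolution of $a$ with itself. Then for every $\lambda>0$ there exist constants $0<\tilde c_-(\lambda)\le\tilde c_+(\lambda)$ such that $$\tilde c_-(\lambda)(1+|x|)^{-(d+\alpha)}\le G_\lambda(x)\le \tilde c_+(\lambda)(1+|x|)^{-(d+\alpha)}\quad\text{for all }x\in\mathbb R^d .$$ Furthermore, the constants $\tilde c_+(\lambda)$ can be chosen so that $\tilde c_+(\lambda)=O(\lambda^{-(2+d+\alpha)})$ as $\lambda\to0^+$, and there is a constant $C_0>0$, independent of $\lambda$ and $x$, such that for every $\lambda>0$ $$G_\lambda(x)\ge\frac{C_0}{\lambda}(1+|x|)^{-(d+\alpha)}$$ for all $x$ with $|x|$ large enough (depending on $\lambda$).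
   Context: The convolution powers are $a_1=a$ and $a_{k+1}(x)=\int_{\mathbb R^d}a(x-y)a_k(y)\,dy$. The function $G_\lambda$ arises from the resolvent of the operator $(L_0u)(x)=\int_{\mathbb R^d}a(x-y)(u(y)-u(x))\,dy$: the kernel of $(\lambda-L_0)^{-1}$ is $(1+\lambda)^{-1}(\delta(x-y)+G_\lambda(x-y))$. *)

theory Defs
  imports "HOL-Analysis.Analysis" "HOL-Library.Landau_Symbols"
begin

text \<open>
  The powers \<open>a\<^sub>k\<close> are indexed by \<open>k \<ge> 1\<close>; the value at \<open>k = 0\<close> (where the true power would be a
  Dirac mass) is a dummy and is never used.
\<close>

fun conv_power :: "('a::euclidean_space \<Rightarrow> real) \<Rightarrow> nat \<Rightarrow> 'a \<Rightarrow> real" where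
  "conv_power a 0 = (\<lambda>x. 0)"
| "conv_power a (Suc 0) = a"
| "conv_power a (Suc (Suc k)) = (\<lambda>x. \<integral>y. a (x - y) * conv_power a (Suc k) y \<partial>lborel)"

text \<open>
  The function \<open>G\<close> for which \<open>(\<delta> + G) / (1 + lam)\<close> is the convolution kernel of the resolvent at \<open>lam\<close>
  of \<open>u \<mapsto> a * u - u\<close>. The sum runs over \<open>k \<ge> 1\<close>, hence the shift.
\<close>

definition resolvent_G :: "('a::euclidean_space \<Rightarrow> real) \<Rightarrow> real \<Rightarrow> 'a \<Rightarrow> real" where
  "resolvent_G a lam x = (\<Sum>k. conv_power a (Suc k) x / (1 + lam) ^ Suc k)"

end

theory Submission
  imports Defs
begin

text \<open>
  Write \<open>p = d + \<alpha>\<close> and \<open>w(x) = (1 + |x|)\<^sup>-\<^sup>p\<close>. If \<open>x = (x - y) + y\<close>, then \<open>|x - y| \<ge> |x|/(k+1)\<close>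
  or \<open>|y| \<ge> k|x|/(k+1)\<close>; bounding \<open>a\<close> in the first case and \<open>a\<^sub>k\<close> in the second gives
  \<open>a\<^sub>k \<le> c\<^sub>+ k\<^sup>p\<^sup>+\<^sup>1 w\<close> by induction. Summing against \<open>(1 + \<lambda>)\<^sup>-\<^sup>k\<close> yields the upper bound and its
  growth \<open>\<lambda>\<^sup>-\<^sup>(\<^sup>p\<^sup>+\<^sup>2\<^sup>)\<close>, and the term \<open>k = 1\<close> alone yields the lower bound for all \<open>x\<close>. For the
  bound at infinity, more than half of the mass of \<open>a\<^sub>k\<close> lies in some ball, so that
  \<open>a\<^sub>k\<^sub>+\<^sub>1(x) \<ge> c w(x)\<close> with the same \<open>c\<close> for every \<open>k\<close> as soon as \<open>|x|\<close> is large depending on \<open>k\<close>;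
  summing finitely many terms of the geometric series gives a multiple of \<open>1/\<lambda>\<close>.
\<close>

section \<open>Integrability and total mass of convolutions\<close>

lemma integrable_lborel_translate:
  fixes f :: "'a::euclidean_space \<Rightarrow> real"
  assumes "integrable lborel f"
  shows "integrable lborel (\<lambda>x. f (x - y))" "(\<integral>x. f (x - y) \<partial>lborel) = (\<integral>x. f x \<partial>lborel)"
proof -
  have D: "distr lborel borel ((+) (- y)) = (lborel :: 'a measure)"
    by (rule lborel_distr_plus)
  have [measurable]: "f \<in> borel_measurable borel"
    using assms by simp
  have "integrable (distr lborel borel ((+) (- y))) f"
    unfolding D by (rule assms)
  then show "integrable lborel (\<lambda>x. f (x - y))"
    by (subst (asm) integrable_distr_eq) auto
  have "(\<integral>x. f x \<partial>lborel) = (\<integral>x. f x \<partial>distr lborel borel ((+) (- y)))"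
    by (simp add: D)
  also have "\<dots> = (\<integral>x. f (x - y) \<partial>lborel)"
    by (subst integral_distr) auto
  finally show "(\<integral>x. f (x - y) \<partial>lborel) = (\<integral>x. f x \<partial>lborel)" ..
qed

text \<open>Integrating |f(x - y) g(y)| in x first gives a constant multiple of |g(y)| by
  translation invariance, so Fubini applies on the product space and the order of integration can be
  exchanged.\<close>

lemma convolution_integrable:
  fixes f g :: "'a::euclidean_space \<Rightarrow> real"
  assumes f: "integrable lborel f" and g: "integrable lborel g"
  shows "integrable lborel (\<lambda>x. \<integral>y. f (x - y) * g y \<partial>lborel)"
    and "(\<integral>x. (\<integral>y. f (x - y) * g y \<partial>lborel) \<partial>lborel) = (\<integral>x. f x \<partial>lborel) * (\<integral>y. g y \<partial>lborel)"
proof -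
  have [measurable]: "f \<in> borel_measurable borel" "g \<in> borel_measurable borel"
    using f g by simp_all
  have *: "(\<integral>x. \<bar>f (x - y)\<bar> \<partial>lborel) = (\<integral>x. \<bar>f x\<bar> \<partial>lborel)" for y
    using integrable_lborel_translate(2)[OF integrable_abs[OF f]] .
  have I: "integrable (lborel \<Otimes>\<^sub>M lborel) (\<lambda>(y, x). f (x - y) * g y)"
  proof (rule lborel_pair.Fubini_integrable)
    show "(\<lambda>(y, x). f (x - y) * g y) \<in> borel_measurable (lborel \<Otimes>\<^sub>M lborel)"
      by measurable
    show "integrable lborel (\<lambda>y. \<integral>x. norm (case (y, x) of (y, x) \<Rightarrow> f (x - y) * g y) \<partial>lborel)"
      using g by (simp add: abs_mult *)
    show "AE y in lborel. integrable lborel (\<lambda>x. case (y, x) of (y, x) \<Rightarrow> f (x - y) * g y)"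
      using integrable_lborel_translate(1)[OF f] by simp
  qed
  show "integrable lborel (\<lambda>x. \<integral>y. f (x - y) * g y \<partial>lborel)"
    using lborel_pair.integrable_snd[OF I] .
  show "(\<integral>x. (\<integral>y. f (x - y) * g y \<partial>lborel) \<partial>lborel) = (\<integral>x. f x \<partial>lborel) * (\<integral>y. g y \<partial>lborel)"
    using lborel_pair.Fubini_integral[OF I] integrable_lborel_translate(2)[OF f] by simp
qed

lemma conv_power_integrable:
  fixes a :: "'a::euclidean_space \<Rightarrow> real"
  assumes "integrable lborel a" "(\<integral>x. a x \<partial>lborel) = 1"
  shows "integrable lborel (conv_power a (Suc k)) \<and> (\<integral>x. conv_power a (Suc k) x \<partial>lborel) = 1"
proof (induction k)
  case 0
  then show ?case using assms by simp
next
  case (Suc k)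
  then show ?case
    using convolution_integrable[OF assms(1), of "conv_power a (Suc k)"] assms(2) by simp
qed

lemma conv_power_nonneg:
  assumes "\<And>x. 0 \<le> a x"
  shows "0 \<le> conv_power a k x"
  using assms by (induction a k arbitrary: x rule: conv_power.induct) (auto intro!: integral_nonneg_AE)

text \<open>Fubini yields integrability of the convolution integrand only for almost every x. A
  bounded factor gives it for every x, as the pointwise comparisons of integrals below
  require.\<close>

lemma integrable_bounded_mult:
  fixes f g :: "'a::euclidean_space \<Rightarrow> real"
  assumes "f \<in> borel_measurable borel" "\<And>x. \<bar>f x\<bar> \<le> B" "integrable lborel g"
  shows "integrable lborel (\<lambda>y. f (x - y) * g y)"
proof (rule Bochner_Integration.integrable_bound)
  show "integrable lborel (\<lambda>y. B * g y)"
    using assms by simp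
  show "(\<lambda>y. f (x - y) * g y) \<in> borel_measurable lborel"
    using assms by (auto intro!: measurable_compose[OF _ assms(1)])
  show "AE y in lborel. norm (f (x - y) * g y) \<le> norm (B * g y)"
    using assms(2) by (auto simp: abs_mult intro!: mult_right_mono order_trans[OF assms(2) abs_ge_self])
qed

section \<open>The decay weight and the upper bound for convolution powers\<close>

text \<open>As t \<le> 1, t(1 + |x|) \<le> 1 + t|x| \<le> 1 + |z|, and a nonpositive power reverses
  this. It transfers the weight between points of comparable norm.\<close>

lemma one_plus_norm_powr_scale:
  fixes x z :: "'a::real_normed_vector"
  assumes "0 \<le> p" "0 < t" "t \<le> 1" "t * norm x \<le> norm z"
  shows "(1 + norm z) powr - p \<le> t powr - p * (1 + norm x) powr - p"
proof -
  have "t * (1 + norm x) \<le> 1 + norm z"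
    using assms by (simp add: algebra_simps)
  moreover have "0 < t * (1 + norm x)"
    using assms by (simp add: add_pos_nonneg)
  ultimately have "(1 + norm z) powr - p \<le> (t * (1 + norm x)) powr - p"
    using assms by (intro powr_mono2') auto
  then show ?thesis
    using assms by (simp add: powr_mult)
qed

text \<open>The uneven split 1 : n of |x| at the n-th step keeps the constants polynomial in n;
  splitting in halves would cost a factor \<open>2 powr p\<close> at every step, too much to sum for
  small \<open>lam\<close>.\<close>

lemma conv_power_upper:
  fixes a :: "'a::euclidean_space \<Rightarrow> real"
  assumes nonneg: "\<And>x. 0 \<le> a x"
    and symm: "\<And>x. a (- x) = a x"
    and intble: "integrable lborel a" and int1: "(\<integral>x. a x \<partial>lborel) = 1"
    and p: "0 \<le> p"
    and upper: "\<And>x. a x \<le> c * (1 + norm x) powr - p"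
  shows "conv_power a (Suc k) x \<le> c * real (Suc k) powr (p + 1) * (1 + norm x) powr - p"
proof (induction k arbitrary: x)
  case 0
  then show ?case using upper by simp
next
  case (Suc k)
  define n where "n = real (Suc k)"
  have n: "0 < n" "real (Suc (Suc k)) = n + 1"
    by (simp_all add: n_def)
  define w where "w = (\<lambda>x::'a. (1 + norm x) powr - p)"
  define b where "b = conv_power a (Suc k)"
  have c: "0 \<le> c"
    using order_trans[OF nonneg[of 0] upper[of 0]] by simp
  have b: "integrable lborel b" "(\<integral>y. b y \<partial>lborel) = 1" "\<And>y. 0 \<le> b y"
    unfolding b_def using conv_power_integrable[OF intble int1] conv_power_nonneg[of a, OF nonneg] by auto
  have IH: "b y \<le> c * n powr (p + 1) * w y" for y
    using Suc.IH unfolding b_def n_def w_def .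
  \<comment> \<open>Evenness makes y \<mapsto> a(x - y) a translate of \<open>a\<close>, hence again
    of mass 1.\<close>
  have flip: "a (x - y) = a (y - x)" for y
    using symm[of "x - y"] by simp
  have A: "integrable lborel (\<lambda>y. a (x - y))" "(\<integral>y. a (x - y) \<partial>lborel) = 1"
    unfolding flip using integrable_lborel_translate[OF intble] int1 by simp_all
  have a_le: "\<bar>a z\<bar> \<le> c" for z
  proof -
    have "(1 + norm z) powr - p \<le> 1 powr - p"
      using p by (intro powr_mono2') auto
    then show ?thesis
      using upper[of z] nonneg[of z] mult_left_mono[OF _ c, of "(1 + norm z) powr - p" 1] by simp
  qed
  \<comment> \<open>Each summand handles one case of the split and is nonnegative in the other, so
    their sum works for all y. In y, each is a constant times a function of mass 1.\<close>
  have le: "a (x - y) * b y \<le> c * (n + 1) powr p * w x * b y + c * n * (n + 1) powr p * w x * a (x - y)"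
    (is "_ \<le> ?A * _ + ?B * _") for y
  proof -
    have nn: "0 \<le> ?A" "0 \<le> ?B"
      using c n by (simp_all add: w_def)
    have "norm x \<le> norm (x - y) + norm y"
      using norm_triangle_ineq[of "x - y" y] by simp
    moreover have "1 / (n + 1) * norm x + n / (n + 1) * norm x = norm x"
      using n by (simp add: distrib_right[symmetric] add_divide_distrib[symmetric] del: times_divide_eq_left)
    ultimately consider "1 / (n + 1) * norm x \<le> norm (x - y)" | "n / (n + 1) * norm x \<le> norm y"
      by linarith
    then show ?thesis
    proof cases
      case 1
      have "w (x - y) \<le> (1 / (n + 1)) powr - p * w x"
        unfolding w_def using 1 n p by (intro one_plus_norm_powr_scale) auto
      also have "(1 / (n + 1)) powr - p = (n + 1) powr p"
        using n by (simp add: powr_divide powr_minus_divide)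
      finally have "c * w (x - y) \<le> ?A"
        using c by (simp add: mult_left_mono mult.assoc)
      then have "a (x - y) \<le> ?A"
        using upper[of "x - y"] by (simp add: w_def)
      then show ?thesis
        using b(3)[of y] nn nonneg[of "x - y"] by (smt (verit) mult_right_mono mult_nonneg_nonneg)
    next
      case 2
      have "w y \<le> (n / (n + 1)) powr - p * w x"
        unfolding w_def using 2 n p by (intro one_plus_norm_powr_scale) auto
      then have "c * n powr (p + 1) * w y \<le> c * n powr (p + 1) * ((n / (n + 1)) powr - p * w x)"
        using c by (intro mult_left_mono) auto
      \<comment> \<open>The \<open>n powr p\<close> in the denominator of the scaling factor cancels
        against the induction hypothesis and leaves a single factor n.\<close>
      also have "\<dots> = ?B"
        using n by (simp add: powr_divide powr_minus_divide powr_add)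
      finally have "b y \<le> ?B"
        using IH[of y] by simp
      then show ?thesis
        using b(3)[of y] nn nonneg[of "x - y"]
        by (smt (verit) mult_left_mono mult_nonneg_nonneg mult.commute)
    qed
  qed
  have "conv_power a (Suc (Suc k)) x = (\<integral>y. a (x - y) * b y \<partial>lborel)"
    by (simp add: b_def)
  also have "\<dots> \<le> (\<integral>y. c * (n + 1) powr p * w x * b y + c * n * (n + 1) powr p * w x * a (x - y) \<partial>lborel)"
    using intble a_le b A
    by (intro integral_mono le integrable_bounded_mult[where B = c]) auto
  also have "\<dots> = c * (n + 1) powr p * w x + c * n * (n + 1) powr p * w x"
    using A b by simp
  \<comment> \<open>The prefactors 1 and n add up to exactly n + 1, which closes the induction with
    exponent p + 1.\<close>
  also have "\<dots> = c * (n + 1) powr (p + 1) * w x"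
    using n by (simp add: powr_add algebra_simps)
  finally show ?case
    unfolding n(2) w_def .
qed

section \<open>Growth of the majorant series as \<open>lam\<close> tends to 0\<close>

lemma powr_le_exp:
  fixes s t :: real
  assumes "0 < s" "0 \<le> t"
  shows "t powr s \<le> s powr s * exp t"
proof -
  have "t / s \<le> exp (t / s)"
    using exp_ge_add_one_self[of "t / s"] by linarith
  then have "(t / s) powr s \<le> exp (t / s) powr s"
    using assms by (intro powr_mono2) auto
  then show ?thesis
    using assms by (simp add: powr_divide exp_powr_real field_simps)
qed

text \<open>With e = ln(1 + lam) the denominator is exp(e k) for the index k \<ge> 1. One half of
  this exponent absorbs \<open>k powr s\<close> at the cost \<open>(2 * s / e) powr s\<close>; the
  other half leaves a geometric series of sum at most 2/e.\<close>

lemma powr_series_bound: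
  fixes s lam :: real
  assumes s: "0 < s" and lam: "0 < lam"
  shows "summable (\<lambda>k. real (Suc k) powr s / (1 + lam) ^ Suc k)"
    and "(\<Sum>k. real (Suc k) powr s / (1 + lam) ^ Suc k)
          \<le> 2 * (2 * s) powr s * ln (1 + lam) powr - (s + 1)"
proof -
  define e where "e = ln (1 + lam)"
  have e: "0 < e" "1 + lam = exp e"
    using lam by (simp_all add: e_def)
  define r where "r = exp (- (e / 2))"
  have r: "0 < r" "r < 1"
    using e by (simp_all add: r_def)
  define K where "K = (2 * s / e) powr s"
  have K: "0 \<le> K" by (simp add: K_def)
  have le: "real (Suc k) powr s / (1 + lam) ^ Suc k \<le> K * r ^ Suc k" for k
  proof -
    define t where "t = e / 2 * real (Suc k)"
    have t: "0 \<le> t" "real (Suc k) = t * (2 / e)"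
      using e by (simp_all add: t_def)
    have "real (Suc k) powr s = t powr s * (2 / e) powr s"
      unfolding t(2) by (rule powr_mult)
    also have "\<dots> \<le> s powr s * exp t * (2 / e) powr s"
      by (intro mult_right_mono powr_le_exp s t(1)) auto
    also have "\<dots> = K * exp t"
      using e s by (simp add: K_def powr_divide powr_mult)
    finally have "real (Suc k) powr s / (1 + lam) ^ Suc k \<le> K * exp t / exp (2 * t)"
      unfolding e(2) exp_of_nat_mult[symmetric] by (simp add: t_def divide_right_mono mult.commute)
    also have "\<dots> = K * exp (- t)"
      unfolding times_divide_eq_right[symmetric] exp_diff[symmetric] by simp
    also have "exp (- t) = r ^ Suc k"
      unfolding r_def exp_of_nat_mult[symmetric] by (simp add: t_def mult.commute)
    finally show ?thesis .
  qed
  have G: "(\<lambda>k. K * r ^ Suc k) sums (K * (r * (1 / (1 - r))))"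
    unfolding power_Suc using r by (intro sums_mult geometric_sums) simp
  show S: "summable (\<lambda>k. real (Suc k) powr s / (1 + lam) ^ Suc k)"
    using lam le by (intro summable_comparison_test'[OF sums_summable[OF G], of 0]) simp
  have "(\<Sum>k. real (Suc k) powr s / (1 + lam) ^ Suc k) \<le> K * (r * (1 / (1 - r)))"
    using suminf_le[OF le S sums_summable[OF G]] sums_unique[OF G] by simp
  also have "\<dots> \<le> K * (2 / e)"
  proof (intro mult_left_mono K)
    have "1 + e / 2 \<le> exp (e / 2)"
      by (rule exp_ge_add_one_self)
    moreover have "r * exp (e / 2) = 1"
      by (simp add: r_def exp_minus)
    ultimately have "r * (1 + e / 2) \<le> 1"
      using r by (metis mult_left_mono less_imp_le)
    \<comment> \<open>The preceding inequality rearranges to r e/2 \<le> 1 - r.\<close>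
    then show "r * (1 / (1 - r)) \<le> 2 / e"
      using r e by (simp add: field_simps)
  qed
  also have "\<dots> = 2 * (2 * s) powr s * e powr - (s + 1)"
    using e s by (simp add: K_def powr_divide powr_minus_divide powr_add powr_diff field_simps)
  finally show "(\<Sum>k. real (Suc k) powr s / (1 + lam) ^ Suc k)
          \<le> 2 * (2 * s) powr s * ln (1 + lam) powr - (s + 1)"
    unfolding e_def .
qed

lemma powr_series_bigo:
  fixes s :: real
  assumes s: "0 < s"
  shows "(\<lambda>lam. \<Sum>k. real (Suc k) powr s / (1 + lam) ^ Suc k)
          \<in> O[at_right 0](\<lambda>lam. lam powr - (s + 1))"
proof (rule bigoI)
  let ?S = "\<lambda>lam. \<Sum>k. real (Suc k) powr s / (1 + lam) ^ Suc k"
  let ?K = "2 * (2 * s) powr s * (1 / 2) powr - (s + 1)"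
  show "\<forall>\<^sub>F lam in at_right 0. norm (?S lam) \<le> ?K * norm (lam powr - (s + 1))"
    unfolding eventually_at_right_field
  proof (intro exI[of _ "1 / 2"] conjI allI impI)
    fix lam :: real
    assume l: "0 < lam" "lam < 1 / 2"
    \<comment> \<open>The restriction \<open>lam < 1 / 2\<close> serves to give ln(1 + lam) \<ge>
      lam/2, so the logarithm can be replaced by \<open>lam\<close> up to a constant.\<close>
    have "lam * (1 / 2) \<le> lam - lam\<^sup>2"
      using l by (simp add: power2_eq_square)
    also have "\<dots> \<le> ln (1 + lam)"
      using l by (intro ln_one_plus_pos_lower_bound) auto
    finally have "ln (1 + lam) powr - (s + 1) \<le> (lam * (1 / 2)) powr - (s + 1)"
      using l s by (intro powr_mono2') auto
    also have "\<dots> = lam powr - (s + 1) * (1 / 2) powr - (s + 1)"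
      by (rule powr_mult)
    finally have "?S lam \<le> 2 * (2 * s) powr s * (lam powr - (s + 1) * (1 / 2) powr - (s + 1))"
      by (intro order_trans[OF powr_series_bound(2)[OF s l(1)]] mult_left_mono) auto
    moreover have "0 \<le> ?S lam"
      using l by (intro suminf_nonneg powr_series_bound s) auto
    ultimately show "norm (?S lam) \<le> ?K * norm (lam powr - (s + 1))"
      by (simp add: mult_ac)
  qed simp
qed

section \<open>The lower bound for convolution powers at infinity\<close>

text \<open>Supplies a ball carrying more than half of the mass of a convolution power.\<close>

lemma integral_cball_tendsto:
  fixes f :: "'a::euclidean_space \<Rightarrow> real"
  assumes "integrable lborel f"
  shows "(\<lambda>n. \<integral>y. indicator (cball 0 (real n)) y * f y \<partial>lborel) \<longlonglongrightarrow> (\<integral>y. f y \<partial>lborel)"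
proof (rule integral_dominated_convergence[where w = "\<lambda>y. \<bar>f y\<bar>"])
  have [measurable]: "f \<in> borel_measurable borel"
    using assms by simp
  show "f \<in> borel_measurable lborel"
    by simp
  show "(\<lambda>y. indicator (cball 0 (real n)) y * f y) \<in> borel_measurable lborel" for n
    by (intro borel_measurable_times borel_measurable_indicator) auto
  show "integrable lborel (\<lambda>y. \<bar>f y\<bar>)"
    using assms by simp
  show "AE y in lborel. norm (indicator (cball 0 (real n)) y * f y) \<le> \<bar>f y\<bar>" for n
    by (simp add: indicator_def)
  show "AE y in lborel. (\<lambda>n. indicator (cball 0 (real n)) y * f y) \<longlonglongrightarrow> f y"
  proof (rule AE_I2, rule tendsto_eventually)
    fix y :: 'a
    show "\<forall>\<^sub>F n in sequentially. indicator (cball 0 (real n)) y * f y = f y"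
      using eventually_ge_at_top[of "nat \<lceil>norm y\<rceil>"]
    proof eventually_elim
      case (elim n)
      then have "norm y \<le> real n" by linarith
      then show ?case by simp
    qed
  qed
qed

text \<open>If y lies in the ball of radius n and |x| \<ge> n, then |x - y| \<le> 2|x|, which costs
  \<open>2 powr - p\<close>; the mass in the ball costs the factor 1/2. Only the radius depends on
  k, not the constant.\<close>

lemma conv_power_lower_at_infinity:
  fixes a :: "'a::euclidean_space \<Rightarrow> real"
  assumes nonneg: "\<And>x. 0 \<le> a x"
    and bdd: "bounded (range a)"
    and intble: "integrable lborel a" and int1: "(\<integral>x. a x \<partial>lborel) = 1"
    and p: "0 \<le> p" and c: "0 \<le> c"
    and lower: "\<And>x. c * (1 + norm x) powr - p \<le> a x"
  shows "\<forall>\<^sub>F x in at_infinity. c * 2 powr - p / 2 * (1 + norm x) powr - p \<le> conv_power a (Suc k) x"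
proof (cases k)
  case 0
  \<comment> \<open>Here the power is \<open>a\<close> itself, so \<open>lower\<close> holds
    everywhere and is merely weakened to the common constant.\<close>
  have "2 powr - p \<le> 1 powr - p"
    using p by (intro powr_mono2') auto
  then have "c * (2 powr - p / 2) * (1 + norm x) powr - p \<le> c * 1 * (1 + norm x) powr - p" for x :: 'a
    using c by (intro mult_left_mono mult_right_mono) auto
  then have "c * 2 powr - p / 2 * (1 + norm x) powr - p \<le> a x" for x
    using lower[of x] by (smt (verit) times_divide_eq_right mult.right_neutral)
  then show ?thesis
    using 0 by simp
next
  case (Suc j)
  define b where "b = conv_power a (Suc j)"
  have b: "integrable lborel b" "(\<integral>y. b y \<partial>lborel) = 1" "\<And>y. 0 \<le> b y"
    unfolding b_def using conv_power_integrable[OF intble int1] conv_power_nonneg[of a, OF nonneg] by auto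
  have [measurable]: "b \<in> borel_measurable borel"
    using b by simp
  obtain B where B: "\<And>x. \<bar>a x\<bar> \<le> B"
    using bdd unfolding bounded_iff by auto
  have "\<forall>\<^sub>F n in sequentially. 1 / 2 < (\<integral>y. indicator (cball 0 (real n)) y * b y \<partial>lborel)"
    using order_tendstoD(1)[OF integral_cball_tendsto[OF b(1)], of "1 / 2"] b(2) by simp
  then obtain n where n: "1 / 2 < (\<integral>y. indicator (cball 0 (real n)) y * b y \<partial>lborel)"
    by (auto simp: eventually_sequentially)
  have I: "integrable lborel (\<lambda>y. indicator (cball 0 (real n)) y * b y)"
    by (rule Bochner_Integration.integrable_bound[OF b(1)]) (auto simp: indicator_def)
  show ?thesis
    unfolding eventually_at_infinity
  proof (intro exI allI impI)
    fix x :: 'a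
    assume x: "real n \<le> norm x"
    define m where "m = c * 2 powr - p * (1 + norm x) powr - p"
    have m: "0 \<le> m"
      using c by (simp add: m_def)
    \<comment> \<open>Inside the ball \<open>m\<close> bounds a(x - y) from below; outside, the left
      side vanishes and the right side is nonnegative.\<close>
    have le: "m * (indicator (cball 0 (real n)) y * b y) \<le> a (x - y) * b y" for y
    proof (cases "norm y \<le> real n")
      case True
      have "norm (x - y) \<le> norm x + norm y"
        by (rule norm_triangle_ineq4)
      then have "1 / 2 * norm (x - y) \<le> norm x"
        using True x by linarith
      then have "(1 + norm x) powr - p \<le> (1 / 2) powr - p * (1 + norm (x - y)) powr - p"
        using p by (intro one_plus_norm_powr_scale) auto
      also have "(1 / 2) powr - p = 2 powr p"
        by (simp add: powr_divide powr_minus_divide)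
      finally have "2 powr - p * (1 + norm x) powr - p
          \<le> 2 powr - p * (2 powr p * (1 + norm (x - y)) powr - p)"
        by (rule mult_left_mono) simp
      also have "\<dots> = (1 + norm (x - y)) powr - p"
        by (simp add: powr_minus)
      finally have "2 powr - p * (1 + norm x) powr - p \<le> (1 + norm (x - y)) powr - p" .
      then have "m \<le> a (x - y)"
        using lower[of "x - y"] mult_left_mono[OF _ c] by (fastforce simp: m_def mult.assoc)
      then show ?thesis
        using True b(3) by (simp add: mult_right_mono)
    next
      case False
      then show ?thesis
        using b(3) nonneg by simp
    qed
    have "c * 2 powr - p / 2 * (1 + norm x) powr - p = m * (1 / 2)"
      by (simp add: m_def)
    also have "\<dots> \<le> m * (\<integral>y. indicator (cball 0 (real n)) y * b y \<partial>lborel)"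
      using n m by (intro mult_left_mono) auto
    also have "\<dots> = (\<integral>y. m * (indicator (cball 0 (real n)) y * b y) \<partial>lborel)"
      by simp
    also have "\<dots> \<le> (\<integral>y. a (x - y) * b y \<partial>lborel)"
      using intble b B
      by (intro integral_mono le integrable_mult_right I) (auto intro!: integrable_bounded_mult[where B = B])
    also have "\<dots> = conv_power a (Suc k) x"
      by (simp add: Suc b_def)
    finally show "c * 2 powr - p / 2 * (1 + norm x) powr - p \<le> conv_power a (Suc k) x" .
  qed
qed

section \<open>Two-sided bounds for the resolvent series\<close>

theorem theorem2p1:
  fixes a :: "'a::euclidean_space \<Rightarrow> real" and \<alpha> c\<^sub>m c\<^sub>p :: real
  assumes nonneg: "\<And>x. 0 \<le> a x"
    and bdd: "bounded (range a)"
    and cont: "continuous_on UNIV a"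
    and symm: "\<And>x. a (- x) = a x"
    and intble: "integrable lborel a"
    and int1: "(\<integral>x. a x \<partial>lborel) = 1"
    and \<alpha>: "0 < \<alpha>"
    and c: "0 < c\<^sub>m" "c\<^sub>m \<le> c\<^sub>p"
    and lower: "\<And>x. c\<^sub>m * (1 + norm x) powr (- (real DIM('a) + \<alpha>)) \<le> a x"
    and upper: "\<And>x. a x \<le> c\<^sub>p * (1 + norm x) powr (- (real DIM('a) + \<alpha>))"
  shows "(\<exists>C\<^sub>m C\<^sub>p :: real \<Rightarrow> real.
            (\<forall>lam>0. 0 < C\<^sub>m lam \<and> C\<^sub>m lam \<le> C\<^sub>p lam \<and>
               (\<forall>x. C\<^sub>m lam * (1 + norm x) powr (- (real DIM('a) + \<alpha>)) \<le> resolvent_G a lam x \<and>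
                    resolvent_G a lam x \<le> C\<^sub>p lam * (1 + norm x) powr (- (real DIM('a) + \<alpha>)))) \<and>
            C\<^sub>p \<in> O[at_right 0](\<lambda>lam. lam powr (- (2 + real DIM('a) + \<alpha>)))) \<and>
         (\<exists>C\<^sub>0>0. \<forall>lam>0. \<exists>R. \<forall>x. R \<le> norm x \<longrightarrow>
            C\<^sub>0 / lam * (1 + norm x) powr (- (real DIM('a) + \<alpha>)) \<le> resolvent_G a lam x)"
proof -
  define p where "p = real DIM('a) + \<alpha>"
  have p: "0 \<le> p"
    using \<alpha> by (simp add: p_def)
  note lower' = lower[folded p_def] and upper' = upper[folded p_def]
  let ?w = "\<lambda>x::'a. (1 + norm x) powr - p"
  define S where "S = (\<lambda>lam::real. \<Sum>k. real (Suc k) powr (p + 1) / (1 + lam) ^ Suc k)"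
  have S_summable: "summable (\<lambda>k. real (Suc k) powr (p + 1) / (1 + lam) ^ Suc k)" if "0 < lam" for lam
    using p that by (intro powr_series_bound) auto
  have term_nonneg: "0 \<le> conv_power a k x / (1 + lam) ^ k" if "0 < lam" for k lam x
    using conv_power_nonneg[of a, OF nonneg] that by simp
  have term_le: "conv_power a (Suc k) x / (1 + lam) ^ Suc k
      \<le> c\<^sub>p * ?w x * (real (Suc k) powr (p + 1) / (1 + lam) ^ Suc k)" if "0 < lam" for k lam x
  proof -
    have "conv_power a (Suc k) x / (1 + lam) ^ Suc k
        \<le> c\<^sub>p * real (Suc k) powr (p + 1) * ?w x / (1 + lam) ^ Suc k"
      using that by (intro divide_right_mono conv_power_upper nonneg symm intble int1 p upper') auto
    then show ?thesis
      by (simp add: mult_ac)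
  qed
  \<comment> \<open>Summability must come first: it is what lets the series be compared with its
    majorant and with its partial sums.\<close>
  have summ: "summable (\<lambda>k. conv_power a (Suc k) x / (1 + lam) ^ Suc k)" if "0 < lam" for lam x
    by (rule summable_comparison_test'[OF summable_mult[OF S_summable[OF that], of "c\<^sub>p * ?w x"], of 0])
      (use term_le[OF that] in \<open>simp only: real_norm_def abs_of_nonneg[OF term_nonneg[OF that]]\<close>)
  have G_le: "resolvent_G a lam x \<le> c\<^sub>p * S lam * ?w x" if "0 < lam" for lam x
  proof -
    have "resolvent_G a lam x \<le> (\<Sum>k. c\<^sub>p * ?w x * (real (Suc k) powr (p + 1) / (1 + lam) ^ Suc k))"
      unfolding resolvent_G_def
      by (intro suminf_le term_le summ summable_mult S_summable that)
    also have "\<dots> = c\<^sub>p * ?w x * S lam"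
      unfolding S_def by (intro suminf_mult S_summable that)
    finally show ?thesis
      by (simp add: mult_ac)
  qed
  have G_ge: "(\<Sum>k<N. conv_power a (Suc k) x / (1 + lam) ^ Suc k) \<le> resolvent_G a lam x"
    if "0 < lam" for lam x N
    unfolding resolvent_G_def using term_nonneg[OF that, of "Suc _"]
    by (intro sum_le_suminf summ that) auto
  have G_ge1: "c\<^sub>m / (1 + lam) * ?w x \<le> resolvent_G a lam x" if "0 < lam" for lam x
  proof -
    have "c\<^sub>m / (1 + lam) * ?w x \<le> a x / (1 + lam)"
      using lower'[of x] that by (simp add: divide_right_mono)
    then show ?thesis
      using G_ge[OF that, where N = 1 and x = x] by simp
  qed
  \<comment> \<open>The first term of \<open>S\<close> alone ensures that the lower constant does
    not exceed the upper one.\<close>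
  have S_ge: "1 / (1 + lam) \<le> S lam" if "0 < lam" for lam
    using sum_le_suminf[OF S_summable[OF that], of "{..<1}"] that by (simp add: S_def)
  have C: "0 < c\<^sub>m / (1 + lam) \<and> c\<^sub>m / (1 + lam) \<le> c\<^sub>p * S lam" if "0 < lam" for lam
    using mult_mono[OF c(2) S_ge[OF that]] c that by simp
  \<comment> \<open>The series has exponent s = p + 1, and summation adds one more power of
    1/lam.\<close>
  have bigo: "(\<lambda>lam. c\<^sub>p * S lam) \<in> O[at_right 0](\<lambda>lam. lam powr - (2 + p))"
    using powr_series_bigo[of "p + 1"] p unfolding S_def by (simp add: add_ac)
  define c0 where "c0 = c\<^sub>m * 2 powr - p / 2"
  have c0: "0 < c0"
    using c by (simp add: c0_def)
  have far: "\<exists>R. \<forall>x. R \<le> norm x \<longrightarrow> c0 / 2 / lam * ?w x \<le> resolvent_G a lam x"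
    if lam: "0 < lam" for lam
  proof -
    define q where "q = 1 / (1 + lam)"
    have q: "0 < q" "q < 1" "1 - q = lam * q"
      using lam by (simp_all add: q_def field_simps)
    \<comment> \<open>The full geometric series sums to 1/lam; this N makes the first N terms reach
      at least half of it, whence the constant \<open>c0 / 2\<close>.\<close>
    obtain N where N: "q ^ N < 1 / 2"
      using real_arch_pow_inv[of "1 / 2" q] q by auto
    have "(\<Sum>k<N. q ^ Suc k) = (1 - q ^ N) / lam"
      using q lam by (simp add: sum_distrib_left[symmetric] sum_gp_strict)
    then have geo: "1 / 2 / lam \<le> (\<Sum>k<N. q ^ Suc k)"
      using N lam divide_right_mono[of "1 / 2" "1 - q ^ N" lam] by linarith
    \<comment> \<open>Only finitely many powers are involved, so one radius serves them all; it
      depends on \<open>lam\<close> through N, while \<open>c0\<close> does not.\<close>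
    have "\<forall>\<^sub>F x in at_infinity. \<forall>k\<in>{..<N}. c0 * ?w x \<le> conv_power a (Suc k) x"
      unfolding c0_def using c
      by (intro eventually_ball_finite finite_lessThan ballI
            conv_power_lower_at_infinity nonneg bdd intble int1 p lower') auto
    then obtain R where R: "\<And>x k. R \<le> norm x \<Longrightarrow> k < N \<Longrightarrow> c0 * ?w x \<le> conv_power a (Suc k) x"
      unfolding eventually_at_infinity by auto
    show ?thesis
    proof (intro exI allI impI)
      fix x :: 'a
      assume x: "R \<le> norm x"
      have "c0 / 2 / lam * ?w x = c0 * ?w x * (1 / 2 / lam)"
        by simp
      also have "\<dots> \<le> c0 * ?w x * (\<Sum>k<N. q ^ Suc k)"
        using c0 geo by (intro mult_left_mono) auto
      also have "\<dots> = (\<Sum>k<N. c0 * ?w x * q ^ Suc k)"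
        by (rule sum_distrib_left)
      also have "\<dots> \<le> (\<Sum>k<N. conv_power a (Suc k) x * q ^ Suc k)"
        using q by (intro sum_mono mult_right_mono R x) auto
      also have "\<dots> = (\<Sum>k<N. conv_power a (Suc k) x / (1 + lam) ^ Suc k)"
        by (simp add: q_def power_divide del: power_Suc)
      also have "\<dots> \<le> resolvent_G a lam x"
        by (rule G_ge[OF lam])
      finally show "c0 / 2 / lam * ?w x \<le> resolvent_G a lam x" .
    qed
  qed
  have exp_eq: "- (2 + real DIM('a) + \<alpha>) = - (2 + p)"
    by (simp add: p_def)
  show ?thesis
    unfolding exp_eq p_def[symmetric]
  proof (intro conjI)
    show "\<exists>C\<^sub>m C\<^sub>p. (\<forall>lam>0. 0 < C\<^sub>m lam \<and> C\<^sub>m lam \<le> C\<^sub>p lam \<and>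
        (\<forall>x. C\<^sub>m lam * ?w x \<le> resolvent_G a lam x \<and> resolvent_G a lam x \<le> C\<^sub>p lam * ?w x)) \<and>
        C\<^sub>p \<in> O[at_right 0](\<lambda>lam. lam powr - (2 + p))"
      by (rule exI[of _ "\<lambda>lam. c\<^sub>m / (1 + lam)"], rule exI[of _ "\<lambda>lam. c\<^sub>p * S lam"])
        (use C G_ge1 G_le bigo in blast)
    show "\<exists>C\<^sub>0>0. \<forall>lam>0. \<exists>R. \<forall>x. R \<le> norm x \<longrightarrow> C\<^sub>0 / lam * ?w x \<le> resolvent_G a lam x"
      using c0 far by (intro exI[of _ "c0 / 2"]) auto
  qed
qed

end
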